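(* The following series identity holds: $$\sum_{k=0}^{\infty}\frac{(1)_k}{(\frac{3}{2})_k(1+2k)}\left\{H_{1+2k}^{(2)}-\frac{1}{4}H_{k}^{(2)}\right\}=2\beta(4).$$
   Context: For a complex number $x$ and a nonnegative integer $n$, the shifted factorial is $(x)_0=1$ and $(x)_n=x(x+1)\cdots(x+n-1)$ for $n\ge 1$. The harmonic numbers of order 2 are $H_n^{(2)}=\sum_{j=1}^n \frac{1}{j^2}$, with $H_0^{(2)}=0$. The constant $\beta(4)$ is $\beta(4)=\sum_{k=0}^{\infty}\frac{(-1)^k}{(1+2k)^4}$. *)

theory Defs
  imports Complex_Main
begin

definition harmonic2 :: "nat \<Rightarrow> real" where
  "harmonic2 n = (\<Sum>j=1..n. 1 / (real j)\<^sup>2)"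

definition beta4 :: real where
  "beta4 = (\<Sum>k::nat. (-1) ^ k / (1 + 2 * real k) ^ 4)"

end

(* With B(k, j) = (C(2k, k+j) - C(2k, k+j+1)) / 4^k, which is twice the probability that a simple
   random walk first reaches 2j+1 at time 2k+1, the k-th term of the series equals
     sum over j <= k of (-1)^j B(k, j) / (2j+1)^4,
   as one sees by a partial fraction expansion or, as here, by a recurrence in k linking the
   moments of orders s and s+2.
   Since B is nonnegative and B(0, j) + B(1, j) + ... = 2 for every j (the walk reaches 2j+1
   almost surely), summing over k first gives 2 * beta(4). *)
theory Submission
  imports Defs "HOL-Analysis.Uniform_Limit"
begin

section \<open>Ballot weights: product form, recurrence in \<open>k\<close>, alternating sum\<close>

definition ballot :: "nat \<Rightarrow> nat \<Rightarrow> real" where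
  "ballot k j = (real ((2 * k) choose (k + j)) - real ((2 * k) choose Suc (k + j))) / 4 ^ k"

text \<open>The ratio of the two neighbouring binomials is (k - j) / (k + j + 1) by absorption.
  Factoring out the larger one turns the difference into a product, from which the sign, the zeros
  for \<open>k < j\<close> and the ratio of consecutive weights can be read off.\<close>

lemma ballot_eq:
  "ballot k j = (2 * real j + 1) / (real k + real j + 1) * real ((2 * k) choose (k + j)) / 4 ^ k"
proof -
  have "(real k + real j + 1) * real ((2 * k) choose Suc (k + j))
      = (real k - real j) * real ((2 * k) choose (k + j))"
  proof (cases "j \<le> k")
    case True
    have "Suc (k + j) * ((2 * k) choose Suc (k + j)) = (2 * k - (k + j)) * ((2 * k) choose (k + j))"
      by (metis binomial_absorb_comp binomial_absorption)
    then have "real (Suc (k + j)) * real ((2 * k) choose Suc (k + j))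
        = real (2 * k - (k + j)) * real ((2 * k) choose (k + j))"
      by (metis of_nat_mult)
    moreover have "real (2 * k - (k + j)) = real k - real j" using True by simp
    ultimately show ?thesis by (simp add: algebra_simps)
  qed (simp add: binomial_eq_0)
  moreover have "real k + real j + 1 \<noteq> 0" by linarith
  ultimately have "real ((2 * k) choose Suc (k + j))
      = (real k - real j) / (real k + real j + 1) * real ((2 * k) choose (k + j))"
    by (simp add: eq_divide_eq mult.commute)
  moreover have "1 - (real k - real j) / (real k + real j + 1) = (2 * real j + 1) / (real k + real j + 1)"
    using \<open>real k + real j + 1 \<noteq> 0\<close> by (simp add: diff_divide_eq_iff)
  ultimately show ?thesis
    unfolding ballot_def by (metis left_diff_distrib mult_1)
qed

lemma ballot_nonneg: "ballot k j \<ge> 0"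
  by (simp add: ballot_eq)

lemma ballot_eq_0: "k < j \<Longrightarrow> ballot k j = 0"
  by (simp add: ballot_eq binomial_eq_0)

text \<open>The left factor equals 4 (k - j + 1) (k + j + 2), the denominator of the ratio of
  consecutive weights. Written as a difference of squares, it confines \<open>j\<close> to the
  single term (2j + 1)^2, which is what lets the recurrence act on sums over
  \<open>j\<close>.\<close>

lemma ballot_Suc:
  assumes "j \<le> Suc k"
  shows "((2 * real k + 3)\<^sup>2 - (2 * real j + 1)\<^sup>2) * ballot (Suc k) j
    = (2 * real k + 1) * (2 * real k + 2) * ballot k j"
proof (cases "j \<le> k")
  case True
  define x where "x = real ((2 * k) choose (k + j))"
  define y where "y = real ((2 * Suc k) choose (Suc k + j))"
  define m where "m = k - j"
  have k: "k = m + j" using True by (simp add: m_def)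
  have x: "x = fact (2 * k) / (fact (k + j) * fact m)"
    unfolding x_def using True by (subst binomial_fact) (auto simp: m_def)
  have "y = fact (2 * Suc k) / (fact (Suc k + j) * fact (Suc m))"
    unfolding y_def using True by (subst binomial_fact) (auto simp: m_def Suc_diff_le)
  also have "fact (2 * Suc k) = (2 * real k + 2) * (2 * real k + 1) * fact (2 * k)"
    by (simp add: algebra_simps)
  also have "fact (Suc k + j) * fact (Suc m)
      = ((real k + real j + 1) * (real m + 1)) * (fact (k + j) * fact m :: real)"
    by (simp add: algebra_simps)
  finally have y: "y = (2 * real k + 2) * (2 * real k + 1) / ((real k + real j + 1) * (real m + 1)) * x"
    unfolding x by simp
  have m: "real m = real k - real j" by (simp add: k)
  have "((2 * real k + 3)\<^sup>2 - (2 * real j + 1)\<^sup>2) = 4 * (real m + 1) * (real k + real j + 2)"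
    unfolding m by (simp add: power2_eq_square algebra_simps)
  moreover have "ballot (Suc k) j = (2 * real j + 1) / (real k + real j + 2) * y / (4 * 4 ^ k)"
    unfolding ballot_eq y_def by (simp add: add_ac)
  moreover have "ballot k j = (2 * real j + 1) / (real k + real j + 1) * x / 4 ^ k"
    unfolding ballot_eq x_def by simp
  ultimately show ?thesis
    unfolding y by simp (simp add: divide_simps)
next
  case False
  \<comment> \<open>On this boundary both sides vanish: the two squares coincide, and
    \<open>ballot k (Suc k)\<close> is 0.\<close>
  then have "j = Suc k" using assms by simp
  then show ?thesis by (simp add: ballot_eq_0 algebra_simps)
qed

lemma choose_Suc_Suc:
  "real (Suc (Suc n) choose Suc (Suc r))
    = real (n choose Suc (Suc r)) + 2 * real (n choose Suc r) + real (n choose r)"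
  by simp

lemma choose_central_pred: "real (Suc (2 * m) choose m) = real (Suc (2 * m) choose Suc m)"
  using binomial_symmetric[of m "Suc (2 * m)"] by (simp add: Suc_diff_le)

text \<open>By Pascal's rule each weight is a difference \<open>u j - u (j + 2)\<close> in row 2m +
  1, so the alternating sum telescopes. What remains is \<open>u 0 - u 1\<close>, zero by the
  symmetry of the odd row, and entries beyond the end of the row. Row \<open>k = 0\<close> is
  excluded: its sum is 1.\<close>

lemma alternating_sum_ballot: "(\<Sum>j\<le>Suc m. (-1) ^ j * ballot (Suc m) j) = 0"
proof -
  define u where "u i = real (Suc (2 * m) choose (m + i))" for i
  have b: "ballot (Suc m) j = (u j - u (j + 2)) / 4 ^ Suc m" for j
    unfolding ballot_def u_def by simp
  have "(\<Sum>j\<le>n. (-1) ^ j * (u j - u (j + 2))) = u 0 - u 1 + (-1) ^ n * (u (n + 1) - u (n + 2))" for n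
    by (induction n) (auto simp: algebra_simps)
  from this[of "Suc m"] have "(\<Sum>j\<le>Suc m. (-1) ^ j * (u j - u (j + 2))) = 0"
    using choose_central_pred[of m] by (simp add: u_def binomial_eq_0)
  then show ?thesis
    unfolding b by (simp add: sum_divide_distrib[symmetric] del: sum.atMost_Suc)
qed

section \<open>Moments of orders 0, 2 and 4\<close>

definition moment :: "nat \<Rightarrow> nat \<Rightarrow> real" where
  "moment s k = (\<Sum>j\<le>k. (-1) ^ j * ballot k j / (2 * real j + 1) ^ s)"

text \<open>Multiply \<open>ballot_Suc\<close> by (-1)^j / (2j + 1)^(s + 2) and sum over
  \<open>j\<close>: the square (2k + 3)^2 comes out of the sum, while (2j + 1)^2 lowers the order by
  two and yields the inhomogeneous term.\<close>

lemma moment_Suc: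
  "(2 * real k + 3)\<^sup>2 * moment (s + 2) (Suc k)
    = (2 * real k + 1) * (2 * real k + 2) * moment (s + 2) k + moment s (Suc k)"
proof -
  \<comment> \<open>The zero term at \<open>j = Suc k\<close> is appended so that both moments run
    over the same range.\<close>
  have "(2 * real k + 1) * (2 * real k + 2) * moment (s + 2) k
      = (2 * real k + 1) * (2 * real k + 2) * (\<Sum>j\<le>Suc k. (-1) ^ j * ballot k j / (2 * real j + 1) ^ (s + 2))"
    unfolding moment_def by (simp add: ballot_eq_0)
  also have "\<dots> = (\<Sum>j\<le>Suc k. (-1) ^ j * ((2 * real k + 1) * (2 * real k + 2) * ballot k j) / (2 * real j + 1) ^ (s + 2))"
    by (simp add: sum_distrib_left mult_ac del: sum.atMost_Suc)
  also have "\<dots> = (\<Sum>j\<le>Suc k. (2 * real k + 3)\<^sup>2 * ((-1) ^ j * ballot (Suc k) j / (2 * real j + 1) ^ (s + 2))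
                   - (-1) ^ j * ballot (Suc k) j / (2 * real j + 1) ^ s)"
  proof (rule sum.cong[OF refl])
    fix j assume "j \<in> {..Suc k}"
    then have j: "j \<le> Suc k" by simp
    have "2 * real j + 1 \<noteq> 0" by linarith
    then have cancel: "x * (2 * real j + 1)\<^sup>2 / (2 * real j + 1) ^ (s + 2) = x / (2 * real j + 1) ^ s" for x
      by (simp add: power_add del: add_2_eq_Suc')
    have split: "u * ((a - d) * b) / q = a * (u * b / q) - u * b * d / q" for u a d b q :: real
      by (simp add: left_diff_distrib right_diff_distrib diff_divide_distrib mult_ac)
    show "(-1) ^ j * ((2 * real k + 1) * (2 * real k + 2) * ballot k j) / (2 * real j + 1) ^ (s + 2)
      = (2 * real k + 3)\<^sup>2 * ((-1) ^ j * ballot (Suc k) j / (2 * real j + 1) ^ (s + 2))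
                   - (-1) ^ j * ballot (Suc k) j / (2 * real j + 1) ^ s"
      unfolding ballot_Suc[OF j, symmetric] cancel[symmetric] by (rule split)
  qed
  also have "\<dots> = (2 * real k + 3)\<^sup>2 * moment (s + 2) (Suc k) - moment s (Suc k)"
    unfolding moment_def by (simp add: sum_subtractf sum_distrib_left del: sum.atMost_Suc)
  finally show ?thesis by simp
qed

text \<open>Since the moment of order 0 vanishes at \<open>Suc k\<close>, the recurrence for order 2
  is homogeneous of first order, and the Pochhammer quotient is its solution with value 1 at
  \<open>k = 0\<close>.\<close>

lemma moment_2: "moment 2 k = pochhammer 1 k / (pochhammer (3/2) k * (1 + 2 * real k))"
proof (induction k)
  case 0
  show ?case by (simp add: moment_def ballot_def)
next
  case (Suc k)
  have nz: "(2 * real k + 3)\<^sup>2 \<noteq> 0" by (simp add: add_nonneg_eq_0_iff)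
  have "moment 0 (Suc k) = 0"
    using alternating_sum_ballot[of k] by (simp add: moment_def)
  then have "moment 2 (Suc k) = (2 * real k + 1) * (2 * real k + 2) * moment 2 k / (2 * real k + 3)\<^sup>2"
    using moment_Suc[of k 0] nz by (simp add: field_simps del: add_2_eq_Suc')
  also have "(2 * real k + 1) * (2 * real k + 2) * moment 2 k = 2 * pochhammer 1 (Suc k) / pochhammer (3/2) k"
    unfolding Suc.IH by (simp add: pochhammer_Suc) (simp add: divide_simps, simp add: algebra_simps)
  also have "\<dots> / (2 * real k + 3)\<^sup>2
      = pochhammer 1 (Suc k) / (pochhammer (3/2) k * ((2 * real k + 3)\<^sup>2 / 2))"
    by simp
  \<comment> \<open>One factor extends \<open>pochhammer (3/2) k\<close>; the other is the new
    linear denominator.\<close>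
  also have "(2 * real k + 3)\<^sup>2 / 2 = (3/2 + real k) * (1 + 2 * real (Suc k))"
    by (simp add: power2_eq_square field_simps)
  finally show ?case
    by (simp add: pochhammer_Suc[of "3/2"] mult.assoc)
qed

lemma harmonic2_Suc: "harmonic2 (Suc n) = harmonic2 n + 1 / (real n + 1)\<^sup>2"
  by (simp add: harmonic2_def add.commute)

text \<open>Variation of constants: \<open>moment 2\<close> solves the homogeneous equation, and the
  quotient of \<open>moment 4\<close> by it grows by 1 / (2k + 3)^2 at each step. The harmonic
  bracket has the same increment, because subtracting a quarter of \<open>harmonic2 k\<close>
  removes the even terms and leaves the sum of the inverse squares of 1, 3, ..., 2k + 1.\<close>

lemma moment_4: "moment 4 k = moment 2 k * (harmonic2 (1 + 2 * k) - 1 / 4 * harmonic2 k)"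
proof (induction k)
  case 0
  show ?case by (simp add: moment_def ballot_def harmonic2_def)
next
  case (Suc k)
  define h where "h = harmonic2 (1 + 2 * k) - 1 / 4 * harmonic2 k"
  have "harmonic2 (1 + 2 * Suc k) = harmonic2 (1 + 2 * k) + 1 / (2 * real k + 2)\<^sup>2 + 1 / (2 * real k + 3)\<^sup>2"
    by (simp add: harmonic2_Suc add_ac)
  moreover have "1 / (2 * real k + 2)\<^sup>2 = 1 / 4 * (1 / (real k + 1)\<^sup>2)"
    by (simp add: divide_simps) (simp add: power2_eq_square algebra_simps)
  ultimately have h: "harmonic2 (1 + 2 * Suc k) - 1 / 4 * harmonic2 (Suc k) = h + 1 / (2 * real k + 3)\<^sup>2"
    unfolding h_def harmonic2_Suc[of k] by (simp add: algebra_simps)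
  have "moment 0 (Suc k) = 0"
    using alternating_sum_ballot[of k] by (simp add: moment_def)
  then have 2: "(2 * real k + 3)\<^sup>2 * moment 2 (Suc k) = (2 * real k + 1) * (2 * real k + 2) * moment 2 k"
    using moment_Suc[of k 0] by (simp del: add_2_eq_Suc')
  have nz: "(2 * real k + 3)\<^sup>2 \<noteq> 0" by (simp add: add_nonneg_eq_0_iff)
  have "(2 * real k + 3)\<^sup>2 * moment 4 (Suc k)
      = (2 * real k + 1) * (2 * real k + 2) * moment 4 k + moment 2 (Suc k)"
    using moment_Suc[of k 2] by simp
  also have "\<dots> = (2 * real k + 3)\<^sup>2 * moment 2 (Suc k) * h + moment 2 (Suc k)"
    unfolding 2 Suc.IH h_def by simp
  also have "\<dots> = (2 * real k + 3)\<^sup>2 * (moment 2 (Suc k) * (h + 1 / (2 * real k + 3)\<^sup>2))"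
    using nz by (simp add: divide_simps) (simp add: algebra_simps)
  finally show ?case
    unfolding h using nz by simp
qed

section \<open>Summing the weights over \<open>k\<close>\<close>

lemma central_binomial_tendsto_0: "(\<lambda>n. real ((2 * n) choose n) / 4 ^ n) \<longlonglongrightarrow> 0"
proof -
  define c where "c n = real ((2 * n) choose n) / 4 ^ n" for n
  have c_Suc: "c (Suc n) = c n * ((2 * real n + 1) / (2 * real n + 2))" for n
  proof -
    have central: "real ((2 * m) choose m) = fact (2 * m) / (fact m * fact m)" for m
      using binomial_fact[of m "2 * m", where 'a = real] by simp
    have "real ((2 * Suc n) choose Suc n) = fact (2 * Suc n) / (fact (Suc n) * fact (Suc n))"
      by (rule central)
    also have "fact (2 * Suc n) = 2 * (real n + 1) * (2 * real n + 1) * fact (2 * n)"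
      by (simp add: algebra_simps)
    also have "fact (Suc n) * fact (Suc n) = (real n + 1) * (real n + 1) * (fact n * fact n)"
      by (simp add: algebra_simps)
    also have "2 * (real n + 1) * (2 * real n + 1) * fact (2 * n) / ((real n + 1) * (real n + 1) * (fact n * fact n))
        = 4 * ((2 * real n + 1) / (2 * real n + 2)) * (fact (2 * n) / (fact n * fact n))"
    proof -
      have "2 * a * b * f / (a * a * g) = 4 * (b / (2 * a)) * (f / g)" if "a \<noteq> 0" for a b f g :: real
        using that by simp
      from this[of "real n + 1"] show ?thesis by simp
    qed
    also have "fact (2 * n) / (fact n * fact n) = real ((2 * n) choose n)"
      by (rule central[symmetric])
    finally have step: "real ((2 * Suc n) choose Suc n)
        = 4 * ((2 * real n + 1) / (2 * real n + 2)) * real ((2 * n) choose n)" .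
    have "4 * q * x / (4 * p) = x / p * q" for p q x :: real
      by simp
    then show ?thesis
      unfolding c_def step power_Suc .
  qed
  \<comment> \<open>The factor 2n + 1 is chosen so that the left side starts at 1 and is multiplied
    at each step by (2n + 1)(2n + 3) / (2n + 2)^2, which is below 1. Hence \<open>c n\<close> decays
    at least like the inverse square root of \<open>n\<close>.\<close>
  have bound: "(c n)\<^sup>2 * (2 * real n + 1) \<le> 1" for n
  proof (induction n)
    case (Suc n)
    have rearrange: "(x * (a / b))\<^sup>2 * d = (x\<^sup>2 * a) * (a * d / b\<^sup>2)" for x a b d :: real
      by (simp add: power_mult_distrib power_divide power2_eq_square)
    have "2 * real (Suc n) + 1 = 2 * real n + 3" by simp
    then have "(c (Suc n))\<^sup>2 * (2 * real (Suc n) + 1)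
        = ((c n)\<^sup>2 * (2 * real n + 1)) * ((2 * real n + 1) * (2 * real n + 3) / (2 * real n + 2)\<^sup>2)"
      unfolding c_Suc by (simp only: rearrange)
    also have "\<dots> \<le> 1 * 1"
    proof (rule mult_mono[OF Suc.IH])
      show "(2 * real n + 1) * (2 * real n + 3) / (2 * real n + 2)\<^sup>2 \<le> 1"
        by (simp add: divide_simps) (simp add: power2_eq_square algebra_simps)
    qed simp_all
    finally show ?case by simp
  qed (simp add: c_def)
  have "(\<lambda>n. (c n)\<^sup>2) \<longlonglongrightarrow> 0"
  proof (rule tendsto_sandwich[OF _ _ tendsto_const])
    show "(\<lambda>n. 1 / real (Suc n)) \<longlonglongrightarrow> 0"
      using lim_1_over_n LIMSEQ_Suc by blast
    show "\<forall>\<^sub>F n in sequentially. (c n)\<^sup>2 \<le> 1 / real (Suc n)"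
    proof (rule always_eventually, rule allI)
      fix n
      have "(c n)\<^sup>2 * real (Suc n) \<le> (c n)\<^sup>2 * (2 * real n + 1)"
        by (rule mult_left_mono) simp_all
      also note bound[of n]
      finally show "(c n)\<^sup>2 \<le> 1 / real (Suc n)"
        by (simp add: pos_le_divide_eq del: of_nat_Suc)
    qed
  qed simp
  then have "c \<longlonglongrightarrow> 0" by simp
  then show ?thesis unfolding c_def .
qed

text \<open>The subtracted term is twice the probability that the walk has not reached 1 by time 2n
  + 1. The induction step is Pascal's rule applied twice, with the symmetry of the even row.\<close>

lemma sum_ballot_0:
  "(\<Sum>k\<le>n. ballot k 0) = 2 - 2 * (real ((2 * Suc n) choose Suc n) / 4 ^ Suc n)"
proof (induction n)
  case (Suc n)
  define x where "x i = real ((2 * Suc n) choose (n + i))" for i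
  have "x 0 = x 2"
    using binomial_symmetric[of n "2 * Suc n"] by (simp add: x_def Suc_diff_le del: binomial_Suc_Suc)
  then have "real ((2 * Suc (Suc n)) choose Suc (Suc n)) = 2 * (x 1 + x 2)"
    using choose_Suc_Suc[of "2 * Suc n" n] by (simp add: x_def del: binomial_Suc_Suc)
  then have a: "real ((2 * Suc (Suc n)) choose Suc (Suc n)) / 4 ^ Suc (Suc n)
      = (x 1 / 4 ^ Suc n + x 2 / 4 ^ Suc n) / 2"
    by (simp only: power_Suc) (simp add: add_divide_distrib)
  have b: "ballot (Suc n) 0 = x 1 / 4 ^ Suc n - x 2 / 4 ^ Suc n"
    by (simp add: ballot_def x_def diff_divide_distrib del: binomial_Suc_Suc)
  have c: "(\<Sum>k\<le>n. ballot k 0) = 2 - 2 * (x 1 / 4 ^ Suc n)"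
    using Suc.IH by (simp add: x_def del: binomial_Suc_Suc)
  show ?case
    unfolding sum.atMost_Suc a b c by (simp add: add_divide_distrib)
qed (simp add: ballot_def)

text \<open>Two steps of Pascal's rule form a discrete heat equation: they change the correction
  term by the second difference \<open>x 0 - 2 * x 1 + x 2\<close>, which is also
  \<open>ballot (Suc n) j - ballot (Suc n) (Suc j)\<close>. As the correction tends to 0, all
  \<open>j\<close> share the same total.\<close>

lemma sum_ballot_Suc:
  "(\<Sum>k\<le>n. ballot k (Suc j))
    = (\<Sum>k\<le>n. ballot k j) - 4 * (real ((2 * Suc n) choose (Suc n + Suc j)) / 4 ^ Suc n)"
proof (induction n)
  case (Suc n)
  define x where "x i = real ((2 * Suc n) choose (Suc (n + j) + i)) / 4 ^ Suc n" for i
  have a: "real ((2 * Suc (Suc n)) choose (Suc (Suc n) + Suc j)) / 4 ^ Suc (Suc n)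
      = (x 2 + 2 * x 1 + x 0) / 4"
    using choose_Suc_Suc[of "2 * Suc n" "Suc (n + j)"]
    by (simp add: x_def add_divide_distrib del: binomial_Suc_Suc)
  have b: "ballot (Suc n) j = x 0 - x 1" "ballot (Suc n) (Suc j) = x 1 - x 2"
    by (simp_all add: ballot_def x_def diff_divide_distrib del: binomial_Suc_Suc)
  have c: "(\<Sum>k\<le>n. ballot k (Suc j)) = (\<Sum>k\<le>n. ballot k j) - 4 * x 1"
    using Suc.IH by (simp add: x_def del: binomial_Suc_Suc)
  show ?case
    unfolding sum.atMost_Suc a b c by (simp add: add_divide_distrib)
qed (cases j; simp add: ballot_def numeral_2_eq_2)

lemma ballot_sums: "(\<lambda>k. ballot k j) sums 2"
proof -
  define c where "c n = real ((2 * Suc n) choose Suc n) / 4 ^ Suc n" for n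
  have c: "c \<longlonglongrightarrow> 0"
    unfolding c_def by (rule LIMSEQ_Suc[OF central_binomial_tendsto_0])
  have "(\<lambda>n. \<Sum>k\<le>n. ballot k j) \<longlonglongrightarrow> 2"
  proof (induction j)
    case 0
    have "(\<lambda>n. 2 - 2 * c n) \<longlonglongrightarrow> 2 - 2 * 0"
      by (intro tendsto_intros c)
    then show ?case unfolding sum_ballot_0 c_def by simp
  next
    case (Suc j)
    define d where "d n = real ((2 * Suc n) choose (Suc n + Suc j)) / 4 ^ Suc n" for n
    \<comment> \<open>No coefficient of an even row exceeds the central one, so the limit for
      \<open>c\<close> also covers the off-centre terms.\<close>
    have "d n \<le> c n" for n
      unfolding c_def d_def using binomial_maximum'[of "Suc n" "Suc n + Suc j"]
      by (intro divide_right_mono) (auto simp del: binomial_Suc_Suc)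
    then have "d \<longlonglongrightarrow> 0"
      by (intro tendsto_sandwich[OF _ _ tendsto_const c]) (auto simp: d_def)
    then have "(\<lambda>n. (\<Sum>k\<le>n. ballot k j) - 4 * d n) \<longlonglongrightarrow> 2 - 4 * 0"
      by (intro tendsto_intros Suc.IH)
    then show ?case unfolding sum_ballot_Suc d_def by simp
  qed
  then show ?thesis by (simp add: sums_def_le)
qed

section \<open>Interchange of the two summations\<close>

theorem theorem1p2:
  "(\<lambda>k::nat. pochhammer (1::real) k / (pochhammer (3/2) k * (1 + 2 * real k))
        * (harmonic2 (1 + 2 * k) - 1 / 4 * harmonic2 k)) sums (2 * beta4)"
proof -
  define e where "e j = (-1) ^ j / (1 + 2 * real j) ^ 4" for j
  \<comment> \<open>The partial sums in \<open>k\<close> lie between 0 and 2 and converge to 2 for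
    each \<open>j\<close>: this is the bound uniform in \<open>n\<close>, and the termwise limit,
    required for dominated convergence of the series over \<open>j\<close>.\<close>
  define P where "P j n = (\<Sum>k\<le>n. ballot k j)" for j n
  have P_nonneg: "P j n \<ge> 0" for j n
    unfolding P_def by (intro sum_nonneg ballot_nonneg)
  have P_le: "P j n \<le> 2" for j n
    unfolding P_def using ballot_sums[of j]
    by (metis ballot_nonneg finite_atMost sum_le_suminf sums_iff)
  have partial_sum: "(\<Sum>k\<le>n. moment 4 k) = (\<Sum>j. e j * P j n)" for n
  proof -
    \<comment> \<open>The triangle \<open>j \<le> k\<close> is enlarged to a square, since the
      weights vanish for \<open>k < j\<close>; the finite sums can then be swapped.\<close>
    have "(\<Sum>k\<le>n. moment 4 k) = (\<Sum>k\<le>n. \<Sum>j\<le>n. e j * ballot k j)"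
    proof (rule sum.cong[OF refl])
      fix k assume "k \<in> {..n}"
      then show "moment 4 k = (\<Sum>j\<le>n. e j * ballot k j)"
        unfolding moment_def e_def
        by (intro sum.mono_neutral_cong_left) (auto simp: ballot_eq_0 add_ac)
    qed
    also have "\<dots> = (\<Sum>j\<le>n. e j * P j n)"
      unfolding P_def by (subst sum.swap) (simp add: sum_distrib_left)
    also have "\<dots> = (\<Sum>j. e j * P j n)"
      by (rule suminf_finite[symmetric]) (auto simp: P_def ballot_eq_0)
    finally show ?thesis .
  qed
  \<comment> \<open>The majorant for Tannery's theorem: 2j + 1 is weakened to j + 1 so that it is a
    shifted inverse power series.\<close>
  have "summable (\<lambda>j. 2 * (1 / real (Suc j) ^ 4))"
    by (intro summable_mult, subst summable_Suc_iff) (use inverse_power_summable[of 4] in \<open>simp add: inverse_eq_divide\<close>)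
  moreover have "norm (e j * P j n) \<le> 2 * (1 / real (Suc j) ^ 4)" for j n
  proof -
    have "\<bar>e j\<bar> \<le> 1 / real (Suc j) ^ 4"
      unfolding e_def by (simp add: abs_divide power_abs) (intro divide_left_mono power_mono; simp)
    then have "\<bar>e j\<bar> * \<bar>P j n\<bar> \<le> 1 / real (Suc j) ^ 4 * 2"
      using P_le P_nonneg by (intro mult_mono) auto
    then show ?thesis by (simp add: abs_mult)
  qed
  moreover have "(\<lambda>n. e j * P j n) \<longlonglongrightarrow> e j * 2" for j
    unfolding P_def using ballot_sums[of j] by (intro tendsto_intros) (simp add: sums_def_le)
  ultimately have lim: "(\<lambda>n. \<Sum>j. e j * P j n) \<longlonglongrightarrow> (\<Sum>j. e j * 2)"
    and "summable (\<lambda>j. norm (e j * 2))"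
    using tannerys_theorem[of "\<lambda>j n. e j * P j n" "\<lambda>j. e j * 2" sequentially
        "\<lambda>j. 2 * (1 / real (Suc j) ^ 4)"] by (auto simp del: of_nat_Suc intro!: always_eventually)
  have "summable e"
    using summable_norm_cancel[OF \<open>summable (\<lambda>j. norm (e j * 2))\<close>] using summable_mult2[of "\<lambda>j. e j * 2" "1/2"] by simp
  then have "(\<Sum>j. e j * 2) = 2 * beta4"
    using suminf_mult2[of e 2] by (simp add: beta4_def e_def[abs_def])
  with lim have "(\<lambda>n. \<Sum>k\<le>n. moment 4 k) \<longlonglongrightarrow> 2 * beta4"
    unfolding partial_sum by simp
  then have "moment 4 sums (2 * beta4)" by (simp add: sums_def_le)
  moreover have "moment 4 = (\<lambda>k. pochhammer 1 k / (pochhammer (3/2) k * (1 + 2 * real k))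
        * (harmonic2 (1 + 2 * k) - 1 / 4 * harmonic2 k))"
    by (rule ext) (simp only: moment_4 moment_2)
  ultimately show ?thesis by simp
qed

end
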